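(* Let $d\in\{2,3\}$ and let $A,B$ be complex $d\times d$ matrices. Then the following are equivalent: (1) $A$ and $B$ have identical pseudospectra, i.e. $\|(zI-A)^{-1}\|=\|(zI-B)^{-1}\|$ for all $z\in\mathbb{C}$; (2) $A$ and $B$ are polynomially isometric, i.e. $\|p(A)\|=\|p(B)\|$ for every polynomial $p$ with complex coefficients.
   Context: $\|\cdot\|$ denotes the spectral (operator) norm induced by the Euclidean norm on $\mathbb{C}^d$. By convention, $\|(zI-T)^{-1}\|=\infty$ when $z$ is an eigenvalue of $T$, so that identical pseudospectra in particular forces equal spectra. For a polynomial $p(z)=c_0+c_1z+\cdots+c_mz^m$, $p(T)=c_0I+c_1T+\cdots+c_mT^m$. *)

theory Defs
  imports "HOL-Analysis.Analysis" "HOL-Computational_Algebra.Polynomial"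
begin

definition spec_norm :: "complex^'n^'n \<Rightarrow> real" where
  "spec_norm M = onorm (\<lambda>x. M *v x)"

fun mat_pow :: "complex^'n^'n \<Rightarrow> nat \<Rightarrow> complex^'n^'n" where
  "mat_pow A 0 = mat 1"
| "mat_pow A (Suc k) = A ** mat_pow A k"

definition poly_mat :: "complex poly \<Rightarrow> complex^'n^'n \<Rightarrow> complex^'n^'n" where
  "poly_mat p A = (\<chi> i j. \<Sum>k\<le>degree p. coeff p k * (mat_pow A k) $ i $ j)"

definition resolvent_norm :: "complex^'n^'n \<Rightarrow> complex \<Rightarrow> ereal" where
  "resolvent_norm A z =
     (if invertible (mat z - A)
      then ereal (spec_norm (matrix_inv (mat z - A)))
      else \<infinity>)"

end

theory Submission
  imports Defs "HOL-Computational_Algebra.Fundamental_Theorem_Algebra"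
begin

text \<open>
  If \<open>A\<close> and \<open>B\<close> are polynomially isometric, then an inverse \<open>(z - A)\<^sup>-\<^sup>1 = q(A)\<close> forces
  \<open>(z - B) q(B) = 1\<close>, because \<open>(z - x) q - 1\<close> vanishes at \<open>A\<close> and hence at \<open>B\<close>.

  Conversely, for \<open>3 \<times> 3\<close> matrices the singular values of \<open>M\<close> are the square roots of the zeros of
  \<open>t\<^sup>3 - \<parallel>M\<parallel>\<^sub>F\<^sup>2 t\<^sup>2 + \<parallel>adj M\<parallel>\<^sub>F\<^sup>2 t - |det M|\<^sup>2\<close>. If \<open>A\<close> and \<open>B\<close> have the same characteristic
  polynomial and \<open>t(z) = \<parallel>(z - A)\<^sup>-\<^sup>1\<parallel>\<^sup>-\<^sup>2\<close>, subtracting the cubics of \<open>z - A\<close> and \<open>z - B\<close>, which share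
  the zero \<open>t(z)\<close>, gives \<open>\<alpha> t(z) = \<alpha> |w|\<^sup>2 + 2 Re (\<beta> cnj w) + \<gamma>\<close> with \<open>w = z - tr A\<close>, where \<open>\<alpha>, \<beta>, \<gamma>\<close>
  are the differences of the Frobenius products of \<open>A\<close> and \<open>A\<^sup>2\<close> and those of \<open>B\<close> and \<open>B\<^sup>2\<close>. If \<open>\<alpha> \<noteq> 0\<close>,
  then \<open>t(z) = |z - \<lambda>|\<^sup>2\<close> for an eigenvalue \<open>\<lambda>\<close>, which makes both matrices equal to the scalar \<open>\<lambda>\<close>.
  So all three differences vanish, and \<open>p(A)\<close> and \<open>p(B)\<close> have the same singular values for every \<open>p\<close>.

  If the characteristic polynomials differ, they are \<open>(x - \<lambda>)\<^sup>2 (x - \<mu>)\<close> and \<open>(x - \<lambda>) (x - \<mu>)\<^sup>2\<close>, and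
  comparing the growth of the resolvents at \<open>\<lambda>\<close> and \<open>\<mu>\<close> shows that \<open>(x - \<lambda>) (x - \<mu>)\<close> annihilates both
  matrices. Whenever a monic quadratic \<open>m\<close> annihilates both (always so for \<open>2 \<times> 2\<close> matrices),
  \<open>(z - A)\<^sup>-\<^sup>1\<close> is \<open>1 / m(z)\<close> times a monic linear polynomial in \<open>A\<close>, so the pseudospectra determine
  the norms of all linear polynomials, and modulo \<open>m\<close> there are no others.
\<close>

section \<open>Polynomials in a matrix\<close>

lemma mat_mult_nth [simp]: "(mat c ** M) $ i $ j = c * M $ i $ j"
  for M :: "complex^'n^'n"
proof -
  have "(\<Sum>k\<in>UNIV. (if i = k then c else 0) * M $ k $ j) =
        (\<Sum>k\<in>UNIV. if i = k then c * M $ k $ j else 0)"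
    by (rule sum.cong) auto
  then show ?thesis
    by (simp add: matrix_matrix_mult_def mat_def)
qed

lemma mult_mat_commute: "M ** mat c = mat c ** M"
  for M :: "complex^'n^'n"
proof -
  have "(M ** mat c) $ i $ j = c * M $ i $ j" for i j
  proof -
    have "(\<Sum>k\<in>UNIV. M $ i $ k * (if k = j then c else 0)) =
          (\<Sum>k\<in>UNIV. if k = j then c * M $ i $ k else 0)"
      by (rule sum.cong) auto
    then show ?thesis
      by (simp add: matrix_matrix_mult_def mat_def)
  qed
  then show ?thesis
    by (simp add: vec_eq_iff)
qed

lemma mat_nth: "mat c $ i $ j = (if i = j then c else 0)"
  by (simp add: mat_def)

lemma mat_add: "mat (a + b) = (mat a + mat b :: complex^'n^'n)"
  by (simp add: vec_eq_iff mat_nth)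

lemma mat_mult_mat: "mat (a * b) = (mat a ** mat b :: complex^'n^'n)"
  by (simp add: vec_eq_iff mat_nth)

lemma mat_zero: "mat 0 = (0 :: complex^'n^'n)"
  by (simp add: vec_eq_iff mat_nth)

lemma matrix_add_rdistrib: "(M + N) ** P = M ** P + N ** P" for M N P :: "complex^'n^'n"
  by (simp add: vec_eq_iff matrix_matrix_mult_def distrib_right sum.distrib)

lemma mat_vec_mult: "mat c *v x = c *s x" for x :: "complex^'n"
proof -
  have "(\<Sum>k\<in>UNIV. (if i = k then c else 0) * x $ k) =
        (\<Sum>k\<in>UNIV. if i = k then c * x $ k else 0)" for i
    by (rule sum.cong) auto
  then show ?thesis
    by (simp add: matrix_vector_mult_def mat_def vec_eq_iff)
qed

lemma poly_mat_nth:
  assumes "degree p \<le> n"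
  shows "poly_mat p A $ i $ j = (\<Sum>k\<le>n. coeff p k * mat_pow A k $ i $ j)"
  unfolding poly_mat_def vec_lambda_beta
  by (rule sum.mono_neutral_left) (use assms in \<open>auto simp: coeff_eq_0\<close>)

lemma poly_mat_0 [simp]: "poly_mat 0 A = 0"
  by (simp add: poly_mat_def vec_eq_iff)

lemma poly_mat_pCons: "poly_mat (pCons a p) A = mat a + A ** poly_mat p A"
proof -
  have "poly_mat (pCons a p) A $ i $ j = (mat a + A ** poly_mat p A) $ i $ j" for i j
  proof -
    have "poly_mat (pCons a p) A $ i $ j =
        (\<Sum>k\<le>Suc (degree p). coeff (pCons a p) k * mat_pow A k $ i $ j)"
      by (rule poly_mat_nth) (simp add: degree_pCons_le)
    also have "\<dots> = a * mat 1 $ i $ j + (\<Sum>k\<le>degree p. coeff p k * (A ** mat_pow A k) $ i $ j)"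
      by (subst sum.atMost_Suc_shift) simp
    also have "(\<Sum>k\<le>degree p. coeff p k * (A ** mat_pow A k) $ i $ j) =
        (\<Sum>l\<in>UNIV. \<Sum>k\<le>degree p. A $ i $ l * (coeff p k * mat_pow A k $ l $ j))"
      by (subst sum.swap) (simp add: matrix_matrix_mult_def sum_distrib_left mult_ac)
    also have "\<dots> = (A ** poly_mat p A) $ i $ j"
      by (simp add: matrix_matrix_mult_def poly_mat_nth[OF order_refl] sum_distrib_left)
    finally show ?thesis
      by (simp add: mat_nth)
  qed
  then show ?thesis
    by (simp add: vec_eq_iff)
qed

lemma poly_mat_add [simp]: "poly_mat (p + q) A = poly_mat p A + poly_mat q A"
  by (induction p q rule: poly_induct2) (simp_all add: poly_mat_pCons mat_add matrix_add_ldistrib)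

lemma poly_mat_smult [simp]: "poly_mat (smult c p) A = mat c ** poly_mat p A"
proof (induction p)
  case (pCons a p)
  have "A ** (mat c ** poly_mat p A) = mat c ** (A ** poly_mat p A)"
    by (metis matrix_mul_assoc mult_mat_commute)
  with pCons show ?case
    by (simp add: poly_mat_pCons matrix_add_ldistrib mat_mult_mat)
qed simp

lemma poly_mat_mult [simp]: "poly_mat (p * q) A = poly_mat p A ** poly_mat q A"
proof (induction p)
  case (pCons a p)
  then show ?case
    by (simp add: poly_mat_pCons matrix_add_rdistrib matrix_mul_assoc mat_zero)
qed simp

lemma poly_mat_uminus [simp]: "poly_mat (- p) A = - poly_mat p A"
  using poly_mat_add[of p "- p" A] by (simp add: eq_neg_iff_add_eq_0 add.commute)

lemma poly_mat_diff [simp]: "poly_mat (p - q) A = poly_mat p A - poly_mat q A"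
  using poly_mat_add[of p "- q" A] by simp

lemma poly_mat_const [simp]: "poly_mat [:c:] A = mat c"
  by (simp add: poly_mat_pCons)

lemma poly_mat_1 [simp]: "poly_mat 1 A = mat 1"
  by (simp add: one_pCons)

lemma poly_mat_quadratic: "poly_mat [:a, b, c:] A = mat a + mat b ** A + mat c ** (A ** A)"
  by (simp add: poly_mat_pCons matrix_add_ldistrib mult_mat_commute[of A] mult_mat_commute[of "A ** A"]
      matrix_mul_assoc)

lemma poly_mat_mod:
  assumes "poly_mat m A = 0"
  shows "poly_mat p A = poly_mat (p mod m) A"
proof -
  have "poly_mat p A = poly_mat (p div m * m + p mod m) A"
    by simp
  also have "\<dots> = poly_mat (p mod m) A"
    by (simp only: poly_mat_add poly_mat_mult assms) simp
  finally show ?thesis .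
qed

section \<open>The spectral norm\<close>

definition cadj :: "complex^'n^'n \<Rightarrow> complex^'n^'n" where
  "cadj M = (\<chi> i j. cnj (M $ j $ i))"

lemma inner_Re_mult: "x \<bullet> y = Re (x * cnj y)" for x y :: complex
  by (simp add: inner_complex_def)

text \<open>The inner product on \<open>complex^'n\<close> is real-valued: it is the real part of
  the Hermitian product. The conjugate transpose is still the adjoint for it.\<close>

lemma inner_cadj: "(M *v x) \<bullet> y = x \<bullet> (cadj M *v y)"
proof -
  have "(M *v x) \<bullet> y = (\<Sum>i\<in>UNIV. \<Sum>j\<in>UNIV. Re (M $ i $ j * x $ j * cnj (y $ i)))"
    by (simp only: inner_vec_def matrix_vector_mult_def inner_Re_mult vec_lambda_beta
        sum_distrib_right Re_sum)
  also have "\<dots> = (\<Sum>j\<in>UNIV. \<Sum>i\<in>UNIV. Re (M $ i $ j * x $ j * cnj (y $ i)))"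
    by (rule sum.swap)
  also have "\<dots> = x \<bullet> (cadj M *v y)"
    by (simp only: inner_vec_def matrix_vector_mult_def inner_Re_mult vec_lambda_beta cadj_def
        sum_distrib_left Re_sum cnj_sum complex_cnj_mult complex_cnj_cnj mult_ac)
  finally show ?thesis .
qed

lemma norm_scale: "norm (c *s x) = norm c * norm x" for x :: "complex^'n"
  by (simp add: norm_vec_def L2_set_def norm_mult power_mult_distrib flip: sum_distrib_left)
     (simp add: real_sqrt_mult)

lemma norm_mult_vec_le: "norm (M *v x) \<le> spec_norm M * norm x"
  unfolding spec_norm_def by (rule onorm) simp

lemma spec_norm_least: "(\<And>x. norm (M *v x) \<le> b * norm x) \<Longrightarrow> spec_norm M \<le> b"
  unfolding spec_norm_def by (rule onorm_le)

lemma spec_norm_nonneg: "0 \<le> spec_norm M"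
  unfolding spec_norm_def by (rule onorm_pos_le) simp

lemma spec_norm_scale: "spec_norm (mat c ** M) = norm c * spec_norm M"
proof -
  have le: "spec_norm (mat c ** M) \<le> norm c * spec_norm M" for c and M :: "complex^'a^'a"
    by (rule spec_norm_least)
       (simp add: norm_scale mat_vec_mult mult.assoc mult_left_mono norm_mult_vec_le
         flip: matrix_vector_mul_assoc)
  show ?thesis
  proof (cases "c = 0")
    case True
    then show ?thesis using le[of c M] spec_norm_nonneg[of "mat c ** M"] by simp
  next
    case False
    then have "M = mat (inverse c) ** (mat c ** M)"
      by (simp add: vec_eq_iff)
    then have "spec_norm M \<le> norm (inverse c) * spec_norm (mat c ** M)"
      using le by metis
    then have "norm c * spec_norm M \<le> spec_norm (mat c ** M)"
      using False by (simp add: norm_divide field_simps)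
    then show ?thesis using le[of c M] by simp
  qed
qed

lemma spec_norm_eq_0_iff: "spec_norm M = 0 \<longleftrightarrow> M = 0"
proof
  assume "spec_norm M = 0"
  then have "M *v x = 0" for x
    using norm_mult_vec_le[of M x] by simp
  then show "M = 0"
    by (simp add: matrix_eq)
next
  assume "M = 0"
  then show "spec_norm M = 0"
    by (simp add: spec_norm_def onorm_zero)
qed

text \<open>The triangle inequality makes the norm convex, and a finite convex function on a
  finite-dimensional space is continuous.\<close>

lemma continuous_spec_norm: "continuous_on UNIV (spec_norm :: complex^'n^'n \<Rightarrow> real)"
proof (rule convex_on_continuous)
  show "convex_on UNIV (spec_norm :: complex^'n^'n \<Rightarrow> real)"
  proof (rule convex_onI)
    fix t :: real and M N :: "complex^'n^'n"
    assume t: "0 < t" "t < 1"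
    show "spec_norm ((1 - t) *\<^sub>R M + t *\<^sub>R N) \<le> (1 - t) * spec_norm M + t * spec_norm N"
    proof (rule spec_norm_least)
      fix x
      have "((1 - t) *\<^sub>R M + t *\<^sub>R N) *v x = (1 - t) *\<^sub>R (M *v x) + t *\<^sub>R (N *v x)"
        by (simp add: vec_eq_iff matrix_vector_mult_def sum.distrib scaleR_sum_right distrib_right)
      also have "norm \<dots> \<le> (1 - t) * norm (M *v x) + t * norm (N *v x)"
        using t by (metis abs_of_pos diff_gt_0_iff_gt norm_scaleR norm_triangle_ineq)
      also have "\<dots> \<le> (1 - t) * (spec_norm M * norm x) + t * (spec_norm N * norm x)"
        using t by (intro add_mono mult_left_mono norm_mult_vec_le) auto
      finally show "norm (((1 - t) *\<^sub>R M + t *\<^sub>R N) *v x)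
          \<le> ((1 - t) * spec_norm M + t * spec_norm N) * norm x"
        by (simp add: algebra_simps)
    qed
  qed simp
qed simp

lemma spec_norm_cadj_le: "spec_norm (cadj M) \<le> spec_norm M"
proof (rule spec_norm_least)
  fix y
  have "(norm (cadj M *v y))\<^sup>2 = (M *v (cadj M *v y)) \<bullet> y"
    by (simp add: power2_norm_eq_inner inner_cadj)
  also have "\<dots> \<le> norm (M *v (cadj M *v y)) * norm y"
    by (rule norm_cauchy_schwarz)
  also have "\<dots> \<le> (spec_norm M * norm (cadj M *v y)) * norm y"
    by (intro mult_right_mono norm_mult_vec_le) auto
  finally show "norm (cadj M *v y) \<le> spec_norm M * norm y"
    by (cases "cadj M *v y = 0") (auto simp: power2_eq_square spec_norm_nonneg algebra_simps)
qed

lemma spec_norm_attained: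
  fixes M :: "complex^'n^'n"
  obtains x where "x \<noteq> 0" "norm (M *v x) = spec_norm M * norm x"
proof -
  obtain i :: 'n where True by blast
  have "compact (sphere (0::complex^'n) 1)" by simp
  moreover have "axis i 1 \<in> sphere (0::complex^'n) 1" by simp
  moreover have "continuous_on (sphere 0 1) (\<lambda>x. norm (M *v x))"
    by (intro continuous_on_norm linear_continuous_on) simp
  ultimately obtain x where x: "norm x = 1" "\<And>y. norm y = 1 \<Longrightarrow> norm (M *v y) \<le> norm (M *v x)"
    using continuous_attains_sup[of "sphere (0::complex^'n) 1" "\<lambda>x. norm (M *v x)"] by auto
  have "spec_norm M \<le> norm (M *v x)"
  proof (rule spec_norm_least)
    fix y :: "complex^'n"
    show "norm (M *v y) \<le> norm (M *v x) * norm y"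
    proof (cases "y = 0")
      case False
      have "norm (M *v (y /\<^sub>R norm y)) \<le> norm (M *v x)"
        using False by (intro x(2)) simp
      then show ?thesis
        using False by (simp add: linear_cmul[OF matrix_vector_mul_linear] field_simps)
    qed simp
  qed
  then have "norm (M *v x) = spec_norm M * norm x"
    using norm_mult_vec_le[of M x] x(1) by simp
  then show ?thesis
    using that[of x] x(1) by force
qed

text \<open>A unit vector at which the norm is attained is a top singular vector. It exists by
  compactness and is an eigenvector by the equality case of Cauchy-Schwarz.\<close>

lemma spec_norm_eigenvector:
  fixes M :: "complex^'n^'n"
  obtains x where "x \<noteq> 0" "cadj M *v (M *v x) = of_real ((spec_norm M)\<^sup>2) *s x"
proof -
  obtain x where x: "x \<noteq> 0" "norm (M *v x) = spec_norm M * norm x"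
    by (rule spec_norm_attained)
  let ?s = "(spec_norm M)\<^sup>2" and ?y = "cadj M *v (M *v x)"
  have "norm ?y \<le> spec_norm M * (spec_norm M * norm x)"
    by (metis x(2) mult_right_mono norm_ge_zero norm_mult_vec_le order_trans spec_norm_cadj_le)
  then have y: "(norm ?y)\<^sup>2 \<le> (?s * norm x)\<^sup>2"
    by (intro power_mono) (auto simp: power2_eq_square)
  have xy: "x \<bullet> ?y = ?s * (norm x)\<^sup>2"
    using x(2) by (simp flip: inner_cadj add: power_mult_distrib flip: power2_norm_eq_inner)
  \<comment> \<open>Expanding this square and using \<open>y\<close> and \<open>xy\<close> bounds it
    by 0, so \<open>?y\<close> is the multiple \<open>?s\<close> of \<open>x\<close>.\<close>
  have "(norm (?y - ?s *\<^sub>R x))\<^sup>2 = (norm ?y)\<^sup>2 - 2 * ?s * (x \<bullet> ?y) + ?s\<^sup>2 * (norm x)\<^sup>2"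
    unfolding power2_norm_eq_inner
    by (simp add: inner_diff_left inner_diff_right inner_commute power2_eq_square)
  also have "\<dots> \<le> 0"
    using y by (simp add: xy algebra_simps power2_eq_square)
  finally have "?y = ?s *\<^sub>R x" by simp
  also have "\<dots> = of_real ?s *s x"
    by (simp add: vec_eq_iff) (simp add: scaleR_conv_of_real)
  finally show ?thesis using that x(1) by blast
qed

lemma resolvent_norm_eq:
  assumes "(mat z - A) ** R = mat 1"
  shows "resolvent_norm A z = ereal (spec_norm R)"
proof -
  have R: "R ** (mat z - A) = mat 1"
    using assms matrix_left_right_inverse by blast
  then have inv: "invertible (mat z - A)"
    using assms invertible_def by blast
  have "\<exists>X. (mat z - A) ** X = mat 1 \<and> X ** (mat z - A) = mat 1"
    using assms R by blast
  then have "(mat z - A) ** matrix_inv (mat z - A) = mat 1"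
    unfolding matrix_inv_def by (rule someI2_ex) blast
  then have "matrix_inv (mat z - A) = R"
    by (metis R matrix_mul_assoc matrix_mul_lid matrix_mul_rid)
  then show ?thesis
    using inv by (simp add: resolvent_norm_def)
qed

lemma resolvent_norm_infinite_iff: "resolvent_norm A z = \<infinity> \<longleftrightarrow> det (mat z - A) = 0"
  using invertible_det_nz[of "mat z - A"] by (auto simp: resolvent_norm_def)

section \<open>Characteristic polynomials in dimensions two and three\<close>

text \<open>The index type is any type with two elements, so the determinant is expanded along an
  arbitrary enumeration of it; dimension three is treated likewise.\<close>

lemma det_two:
  assumes "UNIV = {i, j :: 'n::finite}" "i \<noteq> j"
  shows "det (A :: complex^'n^'n) = A$i$i * A$j$j - A$i$j * A$j$i"
proof -
  have f: "finite {j}" "i \<notin> {j}"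
    using assms by auto
  show ?thesis
    unfolding det_def assms(1) sum_over_permutations_insert[OF f] permutes_sing
    using assms(2)
    by (simp add: sign_swap_id permutation_swap_id sign_compose sign_id swap_id_eq)
qed

lemma det_three:
  assumes "UNIV = {i, j, k :: 'n::finite}" "i \<noteq> j" "j \<noteq> k" "i \<noteq> k"
  shows "det (A :: complex^'n^'n) =
    A$i$i * A$j$j * A$k$k + A$i$j * A$j$k * A$k$i + A$i$k * A$j$i * A$k$j
    - A$i$i * A$j$k * A$k$j - A$i$j * A$j$i * A$k$k - A$i$k * A$j$j * A$k$i"
proof -
  have f: "finite {j, k}" "i \<notin> {j, k}" "finite {k}" "j \<notin> {k}"
    using assms by auto
  show ?thesis
    unfolding det_def assms(1) sum_over_permutations_insert[OF f(1,2)]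
      sum_over_permutations_insert[OF f(3,4)] permutes_sing
    using assms(2-4) assms(2-4)[symmetric]
    by (simp add: sign_swap_id permutation_swap_id sign_compose sign_id swap_id_eq)
qed

text \<open>Second elementary symmetric function of the eigenvalues, written by Newton's identity.
  Using traces alone keeps it free of any order on the indices and computable for polynomials in a
  matrix.\<close>

definition sym2 :: "complex^'n^'n \<Rightarrow> complex" where
  "sym2 M = ((trace M)\<^sup>2 - trace (M ** M)) / 2"

text \<open>For \<open>3 \<times> 3\<close> matrices this is the adjugate, by the Cayley--Hamilton theorem.\<close>

definition adj3 :: "complex^'n^'n \<Rightarrow> complex^'n^'n" where
  "adj3 M = M ** M - mat (trace M) ** M + mat (sym2 M)"

lemma mult_adj3:
  fixes M :: "complex^'n^'n"
  assumes "CARD('n) = 3"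
  shows "M ** adj3 M = mat (det M)"
proof -
  obtain i j k :: 'n where u: "UNIV = {i, j, k}" and ne: "i \<noteq> j" "j \<noteq> k" "i \<noteq> k"
    using assms card_3_iff[of "UNIV :: 'n set"] by metis
  have all: "(\<forall>x. P x) \<longleftrightarrow> P i \<and> P j \<and> P k" for P
    using u by (metis UNIV_I empty_iff insert_iff)
  show ?thesis
    unfolding vec_eq_iff all det_three[OF u ne] adj3_def sym2_def trace_def
    using ne ne[symmetric]
    by (simp add: matrix_matrix_mult_def mat_nth u)
       (intro conjI; simp add: field_simps power2_eq_square)
qed

lemma det_mat_minus:
  fixes M :: "complex^'n^'n"
  assumes "CARD('n) = 3"
  shows "det (mat t - M) = t ^ 3 - trace M * t\<^sup>2 + sym2 M * t - det M"
proof -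
  obtain i j k :: 'n where u: "UNIV = {i, j, k}" and ne: "i \<noteq> j" "j \<noteq> k" "i \<noteq> k"
    using assms card_3_iff[of "UNIV :: 'n set"] by metis
  show ?thesis
    unfolding det_three[OF u ne] sym2_def trace_def
    using ne ne[symmetric]
    by (simp add: matrix_matrix_mult_def mat_nth u)
       (simp add: field_simps power2_eq_square power3_eq_cube)
qed

lemma det_cadj:
  fixes M :: "complex^'n^'n"
  assumes "CARD('n) = 3"
  shows "det (cadj M) = cnj (det M)"
proof -
  obtain i j k :: 'n where u: "UNIV = {i, j, k}" and ne: "i \<noteq> j" "j \<noteq> k" "i \<noteq> k"
    using assms card_3_iff[of "UNIV :: 'n set"] by metis
  show ?thesis
    unfolding det_three[OF u ne] by (simp add: cadj_def)
qed

section \<open>The Frobenius inner product\<close>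

definition gram :: "complex^'n^'n \<Rightarrow> complex^'n^'n \<Rightarrow> complex" where
  "gram M N = (\<Sum>i\<in>UNIV. \<Sum>j\<in>UNIV. M $ i $ j * cnj (N $ i $ j))"

lemma gram_add_left [simp]: "gram (M + N) P = gram M P + gram N P"
  by (simp add: gram_def distrib_right sum.distrib)

lemma gram_add_right [simp]: "gram P (M + N) = gram P M + gram P N"
  by (simp add: gram_def distrib_left sum.distrib)

lemma gram_scale_left [simp]: "gram (mat c ** M) N = c * gram M N"
  by (simp add: gram_def sum_distrib_left mult_ac)

lemma gram_scale_right [simp]: "gram M (mat c ** N) = cnj c * gram M N"
  by (simp add: gram_def sum_distrib_left mult_ac)

lemma cnj_gram: "cnj (gram M N) = gram N M"
  by (simp add: gram_def mult.commute)

lemma gram_mat_right [simp]: "gram M (mat c) = cnj c * trace M"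
proof -
  have "(\<Sum>j\<in>UNIV. M $ i $ j * cnj (if i = j then c else 0)) = cnj c * M $ i $ i" for i
  proof -
    have "(\<Sum>j\<in>UNIV. M $ i $ j * cnj (if i = j then c else 0)) =
          (\<Sum>j\<in>UNIV. if i = j then cnj c * M $ i $ j else 0)"
      by (rule sum.cong) auto
    then show ?thesis by simp
  qed
  then show ?thesis
    by (simp add: gram_def mat_nth trace_def sum_distrib_left)
qed

lemma gram_mat_left [simp]: "gram (mat c) M = c * cnj (trace M)"
  by (metis cnj_gram complex_cnj_cnj complex_cnj_mult gram_mat_right)

lemma gram_self: "gram M M = of_real ((norm M)\<^sup>2)"
  by (simp add: gram_def norm_vec_def L2_set_def sum_nonneg flip: complex_norm_square)

lemma trace_cadj_mult: "trace (cadj M ** M) = of_real ((norm M)\<^sup>2)"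
  unfolding gram_self[symmetric] gram_def trace_def
  by (subst sum.swap) (simp add: matrix_matrix_mult_def cadj_def mult.commute)

text \<open>One diagonal and one off-diagonal cofactor suffice: renaming \<open>i\<close>,
  \<open>j\<close>, \<open>k\<close> yields all nine entries.\<close>

lemma adj3_nth:
  assumes u: "UNIV = {i, j, k :: 'n::finite}" and ne: "i \<noteq> j" "j \<noteq> k" "i \<noteq> k"
  shows "adj3 (M :: complex^'n^'n) $ i $ i = M$j$j * M$k$k - M$j$k * M$k$j"
    and "adj3 M $ i $ j = M$i$k * M$k$j - M$i$j * M$k$k"
  unfolding adj3_def sym2_def trace_def
  using ne ne[symmetric]
  by (simp_all add: matrix_matrix_mult_def mat_nth u)
     (simp_all add: field_simps power2_eq_square)

text \<open>This is Cauchy-Binet: the principal 2x2 minors of \<open>cadj M ** M\<close> add up to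
  the squared moduli of all 2x2 minors of \<open>M\<close>, which up to sign are the entries of the
  adjugate.\<close>

lemma sym2_cadj_mult:
  fixes M :: "complex^'n^'n"
  assumes "CARD('n) = 3"
  shows "sym2 (cadj M ** M) = of_real ((norm (adj3 M))\<^sup>2)"
proof -
  obtain i j k :: 'n where u: "UNIV = {i, j, k}" and ne: "i \<noteq> j" "j \<noteq> k" "i \<noteq> k"
    using assms card_3_iff[of "UNIV :: 'n set"] by metis
  have u': "UNIV = {i, k, j}" "UNIV = {j, i, k}" "UNIV = {j, k, i}" "UNIV = {k, i, j}"
    "UNIV = {k, j, i}"
    using u by auto
  note entries = adj3_nth[OF u ne] adj3_nth[OF u'(1) ne(3) ne(2)[symmetric] ne(1)]
    adj3_nth[OF u'(2) ne(1)[symmetric] ne(3,2)] adj3_nth[OF u'(3) ne(2) ne(3)[symmetric] ne(1)[symmetric]]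
    adj3_nth[OF u'(4) ne(3)[symmetric] ne(1) ne(2)[symmetric]]
    adj3_nth[OF u'(5) ne(2)[symmetric] ne(1)[symmetric] ne(3)[symmetric]]
  show ?thesis
    unfolding gram_self[symmetric] gram_def sym2_def trace_def
    using ne ne[symmetric]
    by (simp add: entries matrix_matrix_mult_def cadj_def u)
       (simp add: field_simps power2_eq_square)
qed

section \<open>Singular values of three-by-three matrices\<close>

lemma det_mat_minus_eq_0_iff: "det (mat c - H) = 0 \<longleftrightarrow> (\<exists>x. x \<noteq> 0 \<and> H *v x = c *s x)"
  for H :: "complex^'n^'n"
proof -
  have "det (mat c - H) \<noteq> 0 \<longleftrightarrow> (\<forall>x. (mat c - H) *v x = 0 \<longrightarrow> x = 0)"
    by (simp add: invertible_left_inverse matrix_left_invertible_ker flip: invertible_det_nz)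
  moreover have "(mat c - H) *v x = 0 \<longleftrightarrow> H *v x = c *s x" for x
    by (simp add: matrix_vector_mult_diff_rdistrib mat_vec_mult) metis
  ultimately show ?thesis by blast
qed

lemma det_mat_minus_cadj_mult:
  fixes M :: "complex^'n^'n"
  assumes "CARD('n) = 3"
  shows "det (mat (of_real t) - cadj M ** M) =
    of_real (t ^ 3 - (norm M)\<^sup>2 * t\<^sup>2 + (norm (adj3 M))\<^sup>2 * t - (norm (det M))\<^sup>2)"
proof -
  have "det (cadj M ** M) = of_real ((norm (det M))\<^sup>2)"
    by (simp add: det_mul det_cadj[OF assms] complex_norm_square mult.commute del: of_real_power)
  then show ?thesis
    by (simp add: det_mat_minus[OF assms] trace_cadj_mult sym2_cadj_mult[OF assms])
qed

text \<open>The three invariants determine the characteristic polynomial of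
  \<open>cadj M ** M\<close>. Hence the squared norm of \<open>M\<close> is also an eigenvalue of
  \<open>cadj N ** N\<close>, which bounds it by the squared norm of \<open>N\<close>; then the
  roles are exchanged.\<close>

lemma spec_norm_eqI:
  fixes M N :: "complex^'n^'n"
  assumes "CARD('n) = 3" "norm M = norm N" "norm (adj3 M) = norm (adj3 N)" "det M = det N"
  shows "spec_norm M = spec_norm N"
proof -
  have le: "spec_norm M \<le> spec_norm N"
    if "norm M = norm N" "norm (adj3 M) = norm (adj3 N)" "det M = det N" for M N :: "complex^'n^'n"
  proof -
    let ?s = "(spec_norm M)\<^sup>2"
    obtain x where "x \<noteq> 0" "cadj M *v (M *v x) = of_real ?s *s x"
      by (rule spec_norm_eigenvector)
    then have "det (mat (of_real ?s) - cadj M ** M) = 0"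
      unfolding det_mat_minus_eq_0_iff by (auto simp flip: matrix_vector_mul_assoc)
    then have "det (mat (of_real ?s) - cadj N ** N) = 0"
      using that by (simp only: det_mat_minus_cadj_mult[OF assms(1)])
    then obtain y where y: "y \<noteq> 0" "cadj N *v (N *v y) = of_real ?s *s y"
      unfolding det_mat_minus_eq_0_iff by (auto simp flip: matrix_vector_mul_assoc)
    have "of_real ?s *s y = ?s *\<^sub>R y"
      by (simp add: vec_eq_iff) (simp add: scaleR_conv_of_real)
    then have "(norm (N *v y))\<^sup>2 = ?s * (norm y)\<^sup>2"
      using y(2) by (simp add: power2_norm_eq_inner inner_cadj)
    then have "norm (N *v y) = spec_norm M * norm y"
      by (metis norm_ge_zero mult_nonneg_nonneg power2_eq_imp_eq power_mult_distrib spec_norm_nonneg)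
    then show ?thesis
      using norm_mult_vec_le[of N y] y(1) by simp
  qed
  show ?thesis
    using le[of M N] le[of N M] assms by simp
qed

lemma cadj_mult: "cadj (M ** N) = cadj N ** cadj M"
  by (simp add: vec_eq_iff cadj_def matrix_matrix_mult_def mult.commute)

lemma cadj_mat: "cadj (mat c) = mat (cnj c)"
  by (simp add: vec_eq_iff cadj_def mat_nth)

text \<open>The reciprocal of the norm of the inverse is a singular value of \<open>M\<close>: if
  \<open>x\<close> is a top singular vector of \<open>R\<close>, then \<open>R *v x\<close> is an
  eigenvector of \<open>cadj M ** M\<close>.\<close>

lemma right_inverse_det_root:
  fixes M :: "complex^'n^'n"
  assumes "M ** R = mat 1"
  shows "spec_norm R > 0" "det (mat (of_real (1 / (spec_norm R)\<^sup>2)) - cadj M ** M) = 0"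
proof -
  have "(mat 1 :: complex^'n^'n) \<noteq> 0"
    by (auto simp: vec_eq_iff mat_nth)
  then have "R \<noteq> 0" using assms by auto
  then show pos: "spec_norm R > 0"
    using spec_norm_eq_0_iff[of R] spec_norm_nonneg[of R] by linarith
  let ?s = "complex_of_real ((spec_norm R)\<^sup>2)"
  obtain x where x: "x \<noteq> 0" "cadj R *v (R *v x) = ?s *s x"
    by (rule spec_norm_eigenvector)
  have My: "M *v (R *v x) = x"
    by (simp add: matrix_vector_mul_assoc assms)
  have "R ** M = mat 1"
    using assms matrix_left_right_inverse by blast
  then have "cadj M ** cadj R = mat 1"
    by (simp add: cadj_mat flip: cadj_mult)
  then have "R *v x = cadj M *v (cadj R *v (R *v x))"
    by (metis matrix_vector_mul_assoc matrix_vector_mul_lid)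
  also have "\<dots> = ?s *s (cadj M *v (M *v (R *v x)))"
    by (simp only: x(2) My vec.scale)
  finally have Rx: "R *v x = ?s *s (cadj M *v (M *v (R *v x)))" .
  have "v = (1 / c) *s w" if "w = c *s v" "c \<noteq> 0" for c :: complex and v w :: "complex^'n"
    using that by (simp add: vec_eq_iff)
  from this[OF Rx] have "cadj M *v (M *v (R *v x)) = (1 / ?s) *s (R *v x)"
    using pos by simp
  moreover have "R *v x \<noteq> 0"
    using My x(1) by auto
  ultimately show "det (mat (of_real (1 / (spec_norm R)\<^sup>2)) - cadj M ** M) = 0"
    unfolding det_mat_minus_eq_0_iff by (auto simp flip: matrix_vector_mul_assoc)
qed

section \<open>Adjugates, traces and Frobenius norms of polynomials in a matrix\<close>

lemma adj3_poly_mat: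
  "adj3 (poly_mat p A) =
   poly_mat (p * p - smult (trace (poly_mat p A)) p + [:sym2 (poly_mat p A):]) A"
  by (simp add: adj3_def)

lemma trace_scale: "trace (mat c ** M) = c * trace M" for M :: "complex^'n^'n"
  by (simp add: trace_def sum_distrib_left)

lemma trace_mat: "trace (mat c :: complex^'n^'n) = c * of_nat CARD('n)"
  by (simp add: trace_def mat_nth)

lemma trace_poly_mat_quadratic:
  "trace (poly_mat [:a, b, c:] A) = a * of_nat CARD('n) + b * trace A + c * trace (A ** A)"
  for A :: "complex^'n^'n"
  by (simp add: poly_mat_quadratic trace_add trace_scale trace_mat)

lemma adj3_mat_minus:
  fixes A :: "complex^'n^'n"
  assumes "CARD('n) = 3"
  shows "adj3 (mat z - A) = poly_mat [:z\<^sup>2 - trace A * z + sym2 A, z - trace A, 1:] A"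
proof -
  have p: "mat z - A = poly_mat [:z, -1, 0:] A"
    unfolding poly_mat_quadratic by (simp add: vec_eq_iff)
  have sq: "[:z, -1, 0:] * [:z, -1, 0:] = [:z\<^sup>2, -2 * z, 1:]"
    by (simp add: power2_eq_square)
  have tr: "trace (poly_mat [:z, -1, 0:] A) = 3 * z - trace A"
    unfolding trace_poly_mat_quadratic by (simp add: assms)
  have tr2: "trace (poly_mat [:z, -1, 0:] A ** poly_mat [:z, -1, 0:] A) =
      3 * z\<^sup>2 - 2 * z * trace A + trace (A ** A)"
    unfolding poly_mat_mult[symmetric] sq trace_poly_mat_quadratic by (simp add: assms)
  have s: "sym2 (poly_mat [:z, -1, 0:] A) = 3 * z\<^sup>2 - 2 * z * trace A + sym2 A"
    unfolding sym2_def tr tr2 by (simp add: field_simps power2_eq_square)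
  show ?thesis
    unfolding p adj3_poly_mat tr s sq
    by (rule arg_cong[where f = "\<lambda>p. poly_mat p A"]) (simp add: algebra_simps power2_eq_square)
qed

text \<open>Every term containing the constant coefficient \<open>a\<close> involves only traces of
  the matrix and its square, so it cancels in the difference.\<close>

lemma norm_poly_mat_quadratic_diff:
  fixes A B :: "complex^'n^'n"
  assumes "trace A = trace B" "trace (A ** A) = trace (B ** B)"
  shows "(norm (poly_mat [:a, b, c:] A))\<^sup>2 - (norm (poly_mat [:a, b, c:] B))\<^sup>2 =
     (norm b)\<^sup>2 * ((norm A)\<^sup>2 - (norm B)\<^sup>2)
   + 2 * Re (cnj b * c * (gram (A ** A) A - gram (B ** B) B))
   + (norm c)\<^sup>2 * ((norm (A ** A))\<^sup>2 - (norm (B ** B))\<^sup>2)" (is "?l = ?r")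
proof -
  have Re2: "of_real (2 * Re w) = w + cnj w" for w
    by (simp add: complex_eq_iff)
  have "complex_of_real ?l = of_real ?r"
    unfolding of_real_add of_real_diff of_real_mult[of "_\<^sup>2"] gram_self[symmetric] Re2
    by (simp add: poly_mat_quadratic assms trace_add trace_scale trace_mat complex_norm_square cnj_gram algebra_simps
        del: of_real_power)
  then show ?thesis
    by (simp only: of_real_eq_iff)
qed

lemma adj3_inverse:
  fixes M :: "complex^'n^'n"
  assumes "CARD('n) = 3" "det M \<noteq> 0"
  shows "M ** (mat (1 / det M) ** adj3 M) = mat 1"
proof -
  have "M ** (mat (1 / det M) ** adj3 M) = mat (1 / det M) ** (M ** adj3 M)"
    by (metis matrix_mul_assoc mult_mat_commute)
  then show ?thesis
    using assms by (simp add: mult_adj3 flip: mat_mult_mat)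
qed

lemma resolvent_norm_three:
  fixes A :: "complex^'n^'n"
  assumes "CARD('n) = 3" "det (mat z - A) \<noteq> 0"
  shows "resolvent_norm A z = ereal (spec_norm (adj3 (mat z - A)) / norm (det (mat z - A)))"
  by (subst resolvent_norm_eq[OF adj3_inverse[OF assms]]) (simp add: spec_norm_scale norm_divide)

lemma cayley_hamilton_three:
  fixes A :: "complex^'n^'n"
  assumes "CARD('n) = 3"
  shows "poly_mat [:- det A, sym2 A, - trace A, 1:] A = 0"
proof -
  have "poly_mat [:sym2 A, - trace A, 1:] A = adj3 A"
    unfolding poly_mat_quadratic adj3_def by (simp add: vec_eq_iff)
  then have "poly_mat [:- det A, sym2 A, - trace A, 1:] A = mat (- det A) + A ** adj3 A"
    by (metis poly_mat_pCons)
  also have "\<dots> = mat (- det A + det A)"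
    using mult_adj3[OF assms, of A] by (simp only: mat_add)
  finally show ?thesis
    by (simp add: mat_zero)
qed

lemma poly_degree_less_three:
  fixes p :: "complex poly"
  assumes "degree p < 3"
  obtains a b c where "p = [:a, b, c:]"
proof
  have "coeff p n = 0" if "n \<ge> 3" for n
    using assms that by (intro coeff_eq_0) simp
  then show "p = [:coeff p 0, coeff p 1, coeff p 2:]"
    by (intro poly_eqI) (simp add: coeff_pCons numeral_2_eq_2 numeral_3_eq_3 split: nat.split)
qed

text \<open>Modulo the common characteristic polynomial every polynomial is a quadratic, so traces
  and Frobenius norms agree for all polynomials. The adjugate of \<open>poly_mat p A\<close> is
  again a polynomial in \<open>A\<close> with coefficients built from traces, so all invariants in
  \<open>spec_norm_eqI\<close> agree.\<close>

lemma isometric_if_gram_eq: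
  fixes A B :: "complex^'n^'n"
  assumes card: "CARD('n) = 3"
    and tr: "trace A = trace B" and s2: "sym2 A = sym2 B" and dt: "det A = det B"
    and g11: "norm A = norm B" and g21: "gram (A ** A) A = gram (B ** B) B"
    and g22: "norm (A ** A) = norm (B ** B)"
  shows "spec_norm (poly_mat p A) = spec_norm (poly_mat p B)"
proof -
  have tr2: "trace (A ** A) = trace (B ** B)"
    using s2 tr by (simp add: sym2_def)
  let ?m = "[:- det A, sym2 A, - trace A, 1:]"
  have reduce: "\<exists>a b c. poly_mat p A = poly_mat [:a, b, c:] A \<and> poly_mat p B = poly_mat [:a, b, c:] B"
    for p
  proof -
    have "degree (p mod ?m) < 3"
      using degree_mod_less'[of ?m p] by (cases "p mod ?m = 0") auto
    then obtain a b c where "p mod ?m = [:a, b, c:]"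
      by (rule poly_degree_less_three)
    moreover have "poly_mat ?m A = 0" "poly_mat ?m B = 0"
      using cayley_hamilton_three[OF card, of A] cayley_hamilton_three[OF card, of B]
      by (simp_all only: tr s2 dt)
    ultimately show ?thesis
      by (metis poly_mat_mod)
  qed
  have trp: "trace (poly_mat p A) = trace (poly_mat p B)" for p
    using reduce[of p] by (metis trace_poly_mat_quadratic tr tr2)
  have np: "norm (poly_mat p A) = norm (poly_mat p B)" for p
  proof -
    obtain a b c where abc: "poly_mat p A = poly_mat [:a, b, c:] A"
      "poly_mat p B = poly_mat [:a, b, c:] B"
      using reduce[of p] by blast
    have "(norm (poly_mat p A))\<^sup>2 = (norm (poly_mat p B))\<^sup>2"
      using norm_poly_mat_quadratic_diff[OF tr tr2, of a b c] g11 g21 g22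
      unfolding abc by simp
    then show ?thesis by simp
  qed
  have s2p: "sym2 (poly_mat p A) = sym2 (poly_mat p B)"
    unfolding sym2_def poly_mat_mult[symmetric] trp ..
  define q where "q = p * p - smult (trace (poly_mat p A)) p + [:sym2 (poly_mat p A):]"
  have q: "adj3 (poly_mat p A) = poly_mat q A" "adj3 (poly_mat p B) = poly_mat q B"
    unfolding adj3_poly_mat q_def by (simp_all only: trp s2p)
  \<comment> \<open>Taking the trace of \<open>M ** adj3 M = mat (det M)\<close> expresses the
    determinant through a trace.\<close>
  have det3: "3 * det M = trace (M ** adj3 M)" for M :: "complex^'n^'n"
    using trace_poly_mat_quadratic[of "det M" 0 0 M] by (simp add: mult_adj3[OF card] card)
  have "3 * det (poly_mat p A) = 3 * det (poly_mat p B)"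
    unfolding det3 q poly_mat_mult[symmetric] trp ..
  then show ?thesis
    by (intro spec_norm_eqI[OF card]) (simp_all add: np q)
qed

section \<open>Scalar matrices from resolvent bounds\<close>

text \<open>The complement of a finite set is dense in the plane. This carries resolvent estimates,
  available only off the spectrum, over to the eigenvalues.\<close>

lemma le_everywhere_if_le_cofinite:
  fixes f g :: "complex \<Rightarrow> real"
  assumes "continuous_on UNIV f" "continuous_on UNIV g" "finite S" "\<And>z. z \<notin> S \<Longrightarrow> f z \<le> g z"
  shows "f z \<le> g z"
proof -
  have "closed {z. f z \<le> g z}"
    using assms(1,2) by (rule closed_Collect_le)
  moreover have "- S \<subseteq> {z. f z \<le> g z}"
    using assms(4) by auto
  ultimately have "closure (- S) \<subseteq> {z. f z \<le> g z}"
    by (rule closure_minimal[rotated])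
  then show ?thesis
    using empty_interior_finite[OF assms(3)] by (auto simp: closure_complement)
qed

text \<open>Along the line of points \<open>r * k\<close> with real \<open>r\<close> the left-hand
  side is \<open>r\<close> times the squared modulus of \<open>k\<close>, which is unbounded unless
  \<open>k\<close> is 0.\<close>

lemma real_affine_bounded_above:
  fixes k :: complex
  assumes "\<And>z. Re (cnj z * k) \<le> d"
  shows "k = 0"
proof (rule ccontr)
  assume k: "k \<noteq> 0"
  have "Re (cnj (of_real r * k) * k) = r * (norm k)\<^sup>2" for r
    by (simp add: cmod_power2) (simp add: power2_eq_square algebra_simps)
  then have "r * (norm k)\<^sup>2 \<le> d" for r
    using assms by metis
  from this[of "(d + 1) / (norm k)\<^sup>2"] show False
    using k by simp
qed

text \<open>The bound says that the field of values of \<open>A - \<lambda>\<close> is \<open>{0}\<close>; polarization does the rest.\<close>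

lemma scalar_if_expanding:
  fixes A :: "complex^'n^'n"
  assumes "\<And>z x. norm (z - l) * norm x \<le> norm ((mat z - A) *v x)"
  shows "A = mat l"
proof -
  define N where "N = A - mat l"
  have "norm h * norm x \<le> norm (h *s x - N *v x)" for h x
    using assms[of "l + h" x]
    by (simp add: N_def mat_add matrix_vector_mult_diff_rdistrib matrix_vector_mult_add_rdistrib
        mat_vec_mult algebra_simps)
  then have sq: "(norm (h *s x))\<^sup>2 \<le> (norm (h *s x - N *v x))\<^sup>2" for h x
    by (simp add: norm_scale power_mono)
  have half: "(h *s x) \<bullet> (N *v x) \<le> (norm (N *v x))\<^sup>2 / 2" for h x
    using sq[of h x] unfolding power2_norm_eq_inner
    by (simp add: inner_diff_left inner_diff_right inner_commute)
  \<comment> \<open>In \<open>half\<close> the right-hand side is independent of \<open>h\<close>.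
    Replacing \<open>h\<close> by real multiples of either sign forces the left-hand side to
    vanish.\<close>
  have zero: "(h *s x) \<bullet> (N *v x) = 0" for h x
  proof -
    define e where "e = (h *s x) \<bullet> (N *v x)"
    have r: "r * e \<le> (norm (N *v x))\<^sup>2 / 2" for r
    proof -
      have "((of_real r * h) *s x) = r *\<^sub>R (h *s x)"
        by (simp add: vec_eq_iff) (simp add: scaleR_conv_of_real)
      then show ?thesis
        using half[of "of_real r * h" x] by (simp add: e_def)
    qed
    have "e = 0"
    proof (rule ccontr)
      assume "e \<noteq> 0"
      with r[of "((norm (N *v x))\<^sup>2 / 2 + 1) / e"] show False by simp
    qed
    then show ?thesis by (simp add: e_def)
  qed
  have polar: "(h *s x) \<bullet> (N *v y) = - ((h *s y) \<bullet> (N *v x))" for h x y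
    using zero[of h "x + y"] zero[of h x] zero[of h y]
    by (simp add: vector_add_ldistrib matrix_vector_right_distrib inner_add_left inner_add_right)
  have skew: "(\<i> *s v) \<bullet> w = - (v \<bullet> (\<i> *s w))" for v w :: "complex^'n"
    by (simp add: inner_vec_def inner_Re_mult flip: sum_negf)
  have "N *v y = 0" for y
  proof -
    \<comment> \<open>\<open>polar\<close> is used with \<open>h = 1\<close> and then with
      \<open>h = \<i>\<close>; with \<open>skew\<close> this gives that
      \<open>?x \<bullet> ?x\<close> equals its own negative.\<close>
    let ?x = "\<i> *s (N *v y)"
    have "?x \<bullet> ?x = ?x \<bullet> (N *v (\<i> *s y))"
      by (simp add: vec.scale)
    also have "\<dots> = - ((\<i> *s y) \<bullet> (N *v ?x))"
      using polar[of 1 ?x "\<i> *s y"] by simp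
    also have "\<dots> = (\<i> *s ?x) \<bullet> (N *v y)"
      using polar[of \<i> y ?x] by simp
    also have "\<dots> = - (?x \<bullet> ?x)"
      by (rule skew)
    finally have "?x = 0" by simp
    then show ?thesis by (simp add: vec_eq_iff)
  qed
  then have "N = 0" by (simp add: matrix_eq)
  then show ?thesis by (simp add: N_def)
qed

section \<open>Equal characteristic polynomials\<close>

lemma finite_det_zeros:
  fixes A :: "complex^'n^'n"
  assumes "CARD('n) = 3"
  shows "finite {z. det (mat z - A) = 0}"
proof -
  have "det (mat z - A) = poly [:- det A, sym2 A, - trace A, 1:] z" for z
    by (simp add: det_mat_minus[OF assms] algebra_simps power2_eq_square power3_eq_cube)
  then show ?thesis
    using poly_roots_finite[of "[:- det A, sym2 A, - trace A, 1:]"] by simp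
qed

lemma gram_eq_if_resolvent_norm_eq:
  fixes A B :: "complex^'n^'n"
  assumes card: "CARD('n) = 3" and res: "\<And>z. resolvent_norm A z = resolvent_norm B z"
    and tr: "trace A = trace B" and s2: "sym2 A = sym2 B" and dt: "det A = det B"
  shows "norm A = norm B \<and> gram (A ** A) A = gram (B ** B) B \<and> norm (A ** A) = norm (B ** B)"
proof -
  have tr2: "trace (A ** A) = trace (B ** B)"
    using s2 tr by (simp add: sym2_def)
  define \<alpha> \<beta> \<gamma> where "\<alpha> = (norm A)\<^sup>2 - (norm B)\<^sup>2" and "\<beta> = gram (A ** A) A - gram (B ** B) B"
    and "\<gamma> = (norm (A ** A))\<^sup>2 - (norm (B ** B))\<^sup>2"
  define S where "S = {z. det (mat z - A) = 0}"
  have fin: "finite S"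
    unfolding S_def by (rule finite_det_zeros[OF card])
  have detAB: "det (mat z - A) = det (mat z - B)" for z
    by (simp add: det_mat_minus[OF card] tr s2 dt)
  define R where "R M z = mat (1 / det (mat z - M)) ** adj3 (mat z - M)" for M :: "complex^'n^'n" and z
  define r where "r z = spec_norm (R A z)" for z
  have RA: "(mat z - A) ** R A z = mat 1" and RB: "(mat z - B) ** R B z = mat 1" if "z \<notin> S" for z
    using that adj3_inverse[OF card, of "mat z - A"] adj3_inverse[OF card, of "mat z - B"]
    by (simp_all add: R_def S_def detAB)
  have rB: "r z = spec_norm (R B z)" if "z \<notin> S" for z
    using res[of z] by (simp add: r_def resolvent_norm_eq[OF RA[OF that]] resolvent_norm_eq[OF RB[OF that]])
  have rpos: "r z > 0" if "z \<notin> S" for z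
    unfolding r_def using right_inverse_det_root(1)[OF RA[OF that]] .
  define t where "t z = 1 / (r z)\<^sup>2" for z
  have tpos: "t z > 0" if "z \<notin> S" for z
    using rpos[OF that] by (simp add: t_def)
  have key: "\<alpha> * t z = (norm (z - trace A))\<^sup>2 * \<alpha> + 2 * Re (cnj (z - trace A) * \<beta>) + \<gamma>"
    if z: "z \<notin> S" for z
  proof -
    have lin: "mat z - M = poly_mat [:z, -1, 0:] M" for M :: "complex^'n^'n"
      unfolding poly_mat_quadratic by (simp add: vec_eq_iff)
    have e1: "(norm (mat z - A))\<^sup>2 - (norm (mat z - B))\<^sup>2 = \<alpha>"
      unfolding lin norm_poly_mat_quadratic_diff[OF tr tr2] by (simp add: \<alpha>_def)
    have e2: "(norm (adj3 (mat z - A)))\<^sup>2 - (norm (adj3 (mat z - B)))\<^sup>2 =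
        (norm (z - trace A))\<^sup>2 * \<alpha> + 2 * Re (cnj (z - trace A) * \<beta>) + \<gamma>"
      unfolding adj3_mat_minus[OF card] s2 tr norm_poly_mat_quadratic_diff[OF tr tr2]
      by (simp add: \<alpha>_def \<beta>_def \<gamma>_def)
    have cubic: "t z ^ 3 - (norm (mat z - M))\<^sup>2 * (t z)\<^sup>2 + (norm (adj3 (mat z - M)))\<^sup>2 * t z
        - (norm (det (mat z - M)))\<^sup>2 = 0" if "(mat z - M) ** R M z = mat 1" "r z = spec_norm (R M z)" for M
      using right_inverse_det_root(2)[OF that(1)]
      unfolding det_mat_minus_cadj_mult[OF card] that(2)[symmetric] t_def[symmetric] of_real_eq_0_iff .
    \<comment> \<open>In the difference of the two cubics the leading terms and the determinants
      cancel, leaving the positive factor \<open>t z\<close>.\<close>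
    have "t z * (((norm (mat z - A))\<^sup>2 - (norm (mat z - B))\<^sup>2) * t z -
        ((norm (adj3 (mat z - A)))\<^sup>2 - (norm (adj3 (mat z - B)))\<^sup>2)) = 0"
      using cubic[OF RA[OF z] r_def] cubic[OF RB[OF z] rB[OF z]]
      by (simp add: detAB algebra_simps power2_eq_square)
    then show ?thesis
      using tpos[OF z] by (simp add: e1 e2)
  qed
  have "\<alpha> = 0"
  proof (rule ccontr)
    assume \<alpha>: "\<alpha> \<noteq> 0"
    \<comment> \<open>\<open>Q\<close> is continuous on the whole plane, so bounds on
      \<open>t\<close> off the finite set \<open>S\<close> become bounds on \<open>Q\<close>
      everywhere, eigenvalues included.\<close>
    define Q where "Q z = (norm (z - trace A))\<^sup>2 + (2 * Re (cnj (z - trace A) * \<beta>) + \<gamma>) / \<alpha>" for z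
    have Q: "t z = Q z" if "z \<notin> S" for z
      using key[OF that] \<alpha> by (simp add: Q_def field_simps)
    have contQ: "continuous_on UNIV Q"
      unfolding Q_def by (intro continuous_intros) (use \<alpha> in auto)
    have expand: "(norm x)\<^sup>2 * t z \<le> (norm ((mat z - M) *v x))\<^sup>2"
      if z: "z \<notin> S" and "M = A \<or> M = B" for z x and M :: "complex^'n^'n"
    proof -
      have "R M z ** (mat z - M) = mat 1"
        using that RA RB matrix_left_right_inverse by blast
      then have "x = R M z *v ((mat z - M) *v x)"
        by (simp add: matrix_vector_mul_assoc)
      then have "norm x \<le> r z * norm ((mat z - M) *v x)"
        using that rB[OF z] r_def norm_mult_vec_le by metis
      then have "(norm x)\<^sup>2 \<le> (r z * norm ((mat z - M) *v x))\<^sup>2"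
        by (intro power_mono) auto
      then show ?thesis
        using rpos[OF z] by (simp add: t_def power_mult_distrib field_simps)
    qed
    obtain l where "poly [:- det A, sym2 A, - trace A, 1:] l = 0"
      using alg_closed_imp_poly_has_root[of "[:- det A, sym2 A, - trace A, 1:]"] by auto
    then have "det (mat l - A) = 0"
      by (simp add: det_mat_minus[OF card] algebra_simps power2_eq_square power3_eq_cube)
    then obtain v where v: "v \<noteq> 0" "A *v v = l *s v"
      unfolding det_mat_minus_eq_0_iff by blast
    have Q0: "0 \<le> Q z" for z
      by (rule le_everywhere_if_le_cofinite[OF _ contQ fin]) (use Q tpos in \<open>auto simp: less_imp_le\<close>)
    have Ql: "Q z \<le> (norm (z - l))\<^sup>2" for z
    proof (rule le_everywhere_if_le_cofinite[OF contQ _ fin])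
      show "continuous_on UNIV (\<lambda>z. (norm (z - l))\<^sup>2)"
        by (intro continuous_intros)
      fix z assume z: "z \<notin> S"
      have "(mat z - A) *v v = (z - l) *s v"
        using v(2) by (simp add: matrix_vector_mult_diff_rdistrib mat_vec_mult vec_eq_iff algebra_simps)
      then have "norm ((mat z - A) *v v) = norm (z - l) * norm v"
        by (simp only: norm_scale)
      then have "(norm v)\<^sup>2 * t z \<le> (norm v)\<^sup>2 * (norm (z - l))\<^sup>2"
        using expand[OF z, of A v] by (simp add: power_mult_distrib mult.commute)
      then show "Q z \<le> (norm (z - l))\<^sup>2"
        using v(1) Q[OF z] by simp
    qed
    \<comment> \<open>\<open>Q z - |z - l|\<^sup>2\<close> is a real-affine function of \<open>z\<close> that is bounded above.\<close>
    define k where "k = 2 * (l - trace A + \<beta> / of_real \<alpha>)"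
    define d where "d = Q 0 - (norm l)\<^sup>2"
    have affine: "Q z - (norm (z - l))\<^sup>2 = Re (cnj z * k) + d" for z
      using \<alpha> unfolding Q_def d_def k_def
      by (simp add: cmod_power2 Re_divide_of_real Im_divide_of_real)
         (simp add: field_simps power2_eq_square)
    have "Re (cnj z * k) \<le> - d" for z
      using affine[of z] Ql[of z] by linarith
    then have "k = 0" by (rule real_affine_bounded_above)
    \<comment> \<open>With \<open>k = 0\<close> the difference is the constant \<open>d\<close>. At
      \<open>z = l\<close> the bounds \<open>Q0\<close> and \<open>Ql\<close> pinch
      \<open>Q l\<close> to 0, so \<open>d = 0\<close>.\<close>
    then have "Q z = (norm (z - l))\<^sup>2" for z
      using affine[of z] affine[of l] Q0[of l] Ql[of z] by simp
    then have t: "t z = (norm (z - l))\<^sup>2" if "z \<notin> S" for z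
      using Q that by simp
    \<comment> \<open>Although \<open>l\<close> was chosen as an eigenvalue of \<open>A\<close>, the
      bound \<open>expand\<close> holds for both matrices with the same \<open>t\<close>, so both
      become the same scalar matrix.\<close>
    have scalar: "M = mat l" if M: "M = A \<or> M = B" for M
    proof (rule scalar_if_expanding)
      fix z x
      show "norm (z - l) * norm x \<le> norm ((mat z - M) *v x)"
      proof (rule le_everywhere_if_le_cofinite[OF _ _ fin])
        show "continuous_on UNIV (\<lambda>z. norm (z - l) * norm x)"
          by (intro continuous_intros)
        have "continuous_on UNIV (\<lambda>z. norm (z *s x - M *v x))"
          unfolding vector_scalar_mult_def by (intro continuous_intros)
        then show "continuous_on UNIV (\<lambda>z. norm ((mat z - M) *v x))"
          by (simp add: matrix_vector_mult_diff_rdistrib mat_vec_mult)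
        fix z assume "z \<notin> S"
        then have "(norm (z - l) * norm x)\<^sup>2 \<le> (norm ((mat z - M) *v x))\<^sup>2"
          using expand[OF _ M, of z x] t by (simp add: power_mult_distrib mult.commute)
        then show "norm (z - l) * norm x \<le> norm ((mat z - M) *v x)"
          by (rule power2_le_imp_le) simp
      qed
    qed
    have "A = B"
      using scalar[of A] scalar[of B] by simp
    then show False
      using \<alpha> by (simp add: \<alpha>_def)
  qed
  have aff: "2 * Re (cnj (z - trace A) * \<beta>) + \<gamma> = 0" for z
  proof -
    have *: "2 * Re (cnj (z - trace A) * \<beta>) + \<gamma> = 0" if "z \<notin> S" for z
      using key[OF that] \<open>\<alpha> = 0\<close> by simp
    have c: "continuous_on UNIV (\<lambda>z. 2 * Re (cnj (z - trace A) * \<beta>) + \<gamma>)"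
      by (intro continuous_intros)
    have "2 * Re (cnj (z - trace A) * \<beta>) + \<gamma> \<le> 0" "0 \<le> 2 * Re (cnj (z - trace A) * \<beta>) + \<gamma>"
      by (rule le_everywhere_if_le_cofinite[OF c _ fin] le_everywhere_if_le_cofinite[OF _ c fin],
          simp, use * in simp)+
    then show ?thesis by simp
  qed
  have "\<gamma> = 0" using aff[of "trace A"] by simp
  moreover have "\<beta> = 0"
  proof (rule real_affine_bounded_above)
    show "Re (cnj z * \<beta>) \<le> 0" for z
      using aff[of "z + trace A"] \<open>\<gamma> = 0\<close> by simp
  qed
  ultimately show ?thesis
    using \<open>\<alpha> = 0\<close> by (simp add: \<alpha>_def \<beta>_def \<gamma>_def)
qed

section \<open>A common quadratic annihilating polynomial\<close>

lemma continuous_spec_norm_poly_mat: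
  assumes "continuous_on UNIV a" "continuous_on UNIV b" "continuous_on UNIV c"
  shows "continuous_on UNIV (\<lambda>z::complex. spec_norm (poly_mat [:a z, b z, c z:] A))"
proof -
  have "poly_mat [:a z, b z, c z:] A =
      (\<chi> i j. a z * mat 1 $ i $ j + b z * A $ i $ j + c z * (A ** A) $ i $ j)" for z
    unfolding poly_mat_quadratic by (simp add: vec_eq_iff mat_nth)
  moreover have "continuous_on UNIV
      (\<lambda>z. \<chi> i j. a z * mat 1 $ i $ j + b z * A $ i $ j + c z * (A ** A) $ i $ j)"
    by (intro continuous_intros assms)
  ultimately have "continuous_on UNIV (\<lambda>z. poly_mat [:a z, b z, c z:] A)"
    by simp
  then show ?thesis
    using continuous_on_compose2[OF continuous_spec_norm] by blast
qed

text \<open>With \<open>m\<close> the quadratic, \<open>(z - x) * (z - a + x) = m(z) - m(x)\<close>,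
  and \<open>m\<close> vanishes at \<open>A\<close>.\<close>

lemma poly_mat_quadratic_inverse:
  fixes A :: "complex^'n^'n"
  assumes "poly_mat [:b, - a, 1:] A = 0" "poly [:b, - a, 1:] z \<noteq> 0"
  shows "(mat z - A) ** (mat (1 / poly [:b, - a, 1:] z) ** poly_mat [:z - a, 1, 0:] A) = mat 1"
proof -
  let ?m = "poly [:b, - a, 1:] z"
  have p: "mat z - A = poly_mat [:z, -1, 0:] A"
    unfolding poly_mat_quadratic by (simp add: vec_eq_iff)
  have eq: "[:z, -1, 0:] * smult (1 / ?m) [:z - a, 1, 0:] =
      1 - smult (1 / ?m) [:b, - a, 1:]"
  proof -
    have "[:z, -1, 0:] * [:z - a, 1, 0:] = [:?m:] - [:b, - a, 1:]"
      by (simp add: algebra_simps)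
    then have "smult (1 / ?m) ([:z, -1, 0:] * [:z - a, 1, 0:]) =
        smult (1 / ?m) [:?m:] - smult (1 / ?m) [:b, - a, 1:]"
      by (simp only: smult_diff_right)
    moreover have "smult (1 / ?m) [:?m:] = 1"
      using assms(2) by (simp only: smult_pCons smult_0_right) (simp add: one_pCons)
    ultimately show ?thesis
      by (simp only: mult_smult_right)
  qed
  show ?thesis
    unfolding p poly_mat_smult[symmetric] poly_mat_mult[symmetric] eq
    by (simp only: poly_mat_diff poly_mat_smult assms(1)) simp
qed

lemma isometric_if_quadratic:
  fixes A B :: "complex^'n^'n"
  assumes mA: "poly_mat [:b, - a, 1:] A = 0" and mB: "poly_mat [:b, - a, 1:] B = 0"
    and res: "\<And>z. resolvent_norm A z = resolvent_norm B z"
  shows "spec_norm (poly_mat p A) = spec_norm (poly_mat p B)"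
proof -
  let ?m = "[:b, - a, 1:]"
  define S where "S = {z. poly ?m z = 0}"
  have fin: "finite S"
    unfolding S_def by (rule poly_roots_finite) simp
  have regular: "spec_norm (poly_mat [:z - a, 1, 0:] A) = spec_norm (poly_mat [:z - a, 1, 0:] B)"
    if "z \<notin> S" for z
  proof -
    have z: "poly ?m z \<noteq> 0"
      using that by (simp add: S_def)
    have "spec_norm (mat (1 / poly ?m z) ** poly_mat [:z - a, 1, 0:] A) =
        spec_norm (mat (1 / poly ?m z) ** poly_mat [:z - a, 1, 0:] B)"
      using res[of z] resolvent_norm_eq[OF poly_mat_quadratic_inverse[OF mA z]]
        resolvent_norm_eq[OF poly_mat_quadratic_inverse[OF mB z]] by (metis ereal.inject)
    then show ?thesis
      unfolding spec_norm_scale using z by (simp only: mult_cancel_left) (simp add: norm_divide)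
  qed
  have cont: "continuous_on UNIV (\<lambda>z. spec_norm (poly_mat [:z - a, 1, 0:] M))" for M :: "complex^'n^'n"
    by (intro continuous_spec_norm_poly_mat continuous_intros)
  have "spec_norm (poly_mat [:z - a, 1, 0:] A) = spec_norm (poly_mat [:z - a, 1, 0:] B)" for z
    using le_everywhere_if_le_cofinite[OF cont[of A] cont[of B] fin, of z]
      le_everywhere_if_le_cofinite[OF cont[of B] cont[of A] fin, of z] regular
    by (simp add: order_antisym)
  \<comment> \<open>As \<open>z\<close> runs through the plane so does \<open>z - a\<close>, so
    every monic linear polynomial is reached.\<close>
  from this[of "_ + a"]
  have monic: "spec_norm (poly_mat [:w, 1, 0:] A) = spec_norm (poly_mat [:w, 1, 0:] B)" for w
    by simp
  obtain c d where cd: "p mod ?m = [:c, d, 0:]"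
  proof
    have "degree (p mod ?m) < 2"
      using degree_mod_less'[of ?m p] by (cases "p mod ?m = 0") auto
    then have "coeff (p mod ?m) n = 0" if "n \<ge> 2" for n
      using that by (intro coeff_eq_0) simp
    then show "p mod ?m = [:coeff (p mod ?m) 0, coeff (p mod ?m) 1, 0:]"
      by (intro poly_eqI) (simp add: coeff_pCons numeral_2_eq_2 split: nat.split)
  qed
  have "spec_norm (poly_mat [:c, d, 0:] A) = spec_norm (poly_mat [:c, d, 0:] B)"
  proof (cases "d = 0")
    case False
    then have "[:c, d, 0:] = smult d [:c / d, 1, 0:]" by simp
    then show ?thesis
      by (simp only: poly_mat_smult spec_norm_scale monic)
  qed simp
  then show ?thesis
    using poly_mat_mod[OF mA, of p] poly_mat_mod[OF mB, of p] cd by simp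
qed

text \<open>Clearing determinants and common factors balances the adjugate of
  \<open>mat z - A\<close> times \<open>z - m\<close> against that of \<open>mat z - B\<close> times
  \<open>z - l\<close>, in norm. By continuity this holds at \<open>l\<close> and \<open>m\<close>,
  where one side vanishes; so the adjugates of \<open>mat l - A\<close> and \<open>mat m - B\<close>
  are zero, and each is the claimed quadratic.\<close>

lemma quadratic_annihilator:
  fixes A B :: "complex^'n^'n"
  assumes card: "CARD('n) = 3" and res: "\<And>z. resolvent_norm A z = resolvent_norm B z"
    and A: "trace A = 2 * l + m" "sym2 A = l\<^sup>2 + 2 * l * m" "det A = l\<^sup>2 * m"
    and B: "trace B = l + 2 * m" "sym2 B = m\<^sup>2 + 2 * l * m" "det B = l * m\<^sup>2"
    and ne: "l \<noteq> m"
  shows "poly_mat [:l * m, - (l + m), 1:] A = 0" "poly_mat [:l * m, - (l + m), 1:] B = 0"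
proof -
  have detA: "det (mat z - A) = (z - l)\<^sup>2 * (z - m)" for z
    by (simp add: det_mat_minus[OF card] A algebra_simps power2_eq_square power3_eq_cube)
  have detB: "det (mat z - B) = (z - l) * (z - m)\<^sup>2" for z
    by (simp add: det_mat_minus[OF card] B algebra_simps power2_eq_square power3_eq_cube)
  define f where "f M z = spec_norm (adj3 (mat z - M))" for M :: "complex^'n^'n" and z
  have cont: "continuous_on UNIV (f M)" for M
    unfolding f_def adj3_mat_minus[OF card]
    by (intro continuous_spec_norm_poly_mat continuous_intros)
  have reg: "f A z * norm (z - m) = f B z * norm (z - l)" if "z \<notin> {l, m}" for z
  proof -
    have nz: "det (mat z - A) \<noteq> 0" "det (mat z - B) \<noteq> 0"
      using that by (auto simp: detA detB)
    have "f A z / norm (det (mat z - A)) = f B z / norm (det (mat z - B))"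
      using res[of z] by (simp add: resolvent_norm_three[OF card nz(1)]
          resolvent_norm_three[OF card nz(2)] f_def)
    then have "norm (z - l) * norm (z - m) * (f A z * norm (z - m)) =
        norm (z - l) * norm (z - m) * (f B z * norm (z - l))"
      using that unfolding detA detB norm_mult norm_power
      by (subst (asm) frac_eq_eq) (auto simp: power2_eq_square mult_ac)
    then show ?thesis
      using that by simp
  qed
  have cA: "continuous_on UNIV (\<lambda>z. f A z * norm (z - m))"
    and cB: "continuous_on UNIV (\<lambda>z. f B z * norm (z - l))"
    by (intro continuous_intros cont)+
  have eq: "f A z * norm (z - m) = f B z * norm (z - l)" for z
  proof (rule antisym)
    show "f A z * norm (z - m) \<le> f B z * norm (z - l)"
      by (rule le_everywhere_if_le_cofinite[OF cA cB, of "{l, m}"]) (use reg in auto)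
    show "f B z * norm (z - l) \<le> f A z * norm (z - m)"
      by (rule le_everywhere_if_le_cofinite[OF cB cA, of "{l, m}"]) (use reg in auto)
  qed
  have "adj3 (mat l - A) = 0"
    using eq[of l] ne by (simp add: f_def spec_norm_eq_0_iff)
  moreover have "l\<^sup>2 - (2 * l + m) * l + (l\<^sup>2 + 2 * l * m) = l * m" "l - (2 * l + m) = - (l + m)"
    by (simp_all add: algebra_simps power2_eq_square)
  ultimately show "poly_mat [:l * m, - (l + m), 1:] A = 0"
    unfolding adj3_mat_minus[OF card] A by metis
  have "adj3 (mat m - B) = 0"
    using eq[of m] ne by (simp add: f_def spec_norm_eq_0_iff)
  moreover have "m\<^sup>2 - (l + 2 * m) * m + (m\<^sup>2 + 2 * l * m) = l * m" "m - (l + 2 * m) = - (l + m)"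
    by (simp_all add: algebra_simps power2_eq_square)
  ultimately show "poly_mat [:l * m, - (l + m), 1:] B = 0"
    unfolding adj3_mat_minus[OF card] B by metis
qed

section \<open>Roots of characteristic polynomials and comparison of spectra\<close>

lemma quadratic_roots:
  fixes s p :: complex
  obtains a b where "s = a + b" "p = a * b"
proof -
  obtain a where "poly [:p, - s, 1:] a = 0"
    using alg_closed_imp_poly_has_root[of "[:p, - s, 1:]"] by auto
  then have "p = a * (s - a)"
    by (simp add: algebra_simps)
  then show ?thesis
    using that[of a "s - a"] by simp
qed

lemma cubic_roots:
  fixes s p q :: complex
  obtains a b c where "s = a + b + c" "p = a * b + a * c + b * c" "q = a * b * c"
proof -
  obtain a where a: "poly [:- q, p, - s, 1:] a = 0"
    using alg_closed_imp_poly_has_root[of "[:- q, p, - s, 1:]"] by auto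
  obtain b c where bc: "s - a = b + c" "p - a * (s - a) = b * c"
    by (rule quadratic_roots)
  have s: "s = a + b + c"
    using bc(1) by (simp add: algebra_simps)
  moreover have p: "p = a * b + a * c + b * c"
    using bc(2) unfolding s by (simp add: algebra_simps)
  moreover have "q = a * b * c"
    using a unfolding s p by (simp add: algebra_simps)
  ultimately show ?thesis by (rule that)
qed

text \<open>Triples with the same underlying set can differ as multisets only when that set has two
  elements and the double entry is exchanged.\<close>

lemma triple_same_set:
  assumes "{a, b, c} = {a', b', c'}"
  obtains "(a', b', c') \<in> {(a, b, c), (a, c, b), (b, a, c), (b, c, a), (c, a, b), (c, b, a)}"
  | l m where "l \<noteq> m" "(a, b, c) \<in> {(l, l, m), (l, m, l), (m, l, l)}"
    "(a', b', c') \<in> {(l, m, m), (m, l, m), (m, m, l)}"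
proof -
  have "a \<in> {a', b', c'}" "b \<in> {a', b', c'}" "c \<in> {a', b', c'}"
    "a' \<in> {a, b, c}" "b' \<in> {a, b, c}" "c' \<in> {a, b, c}"
    using assms by auto
  then have "(a', b', c') \<in> {(a, b, c), (a, c, b), (b, a, c), (b, c, a), (c, a, b), (c, b, a)} \<or>
    (\<exists>l m. l \<noteq> m \<and> (a, b, c) \<in> {(l, l, m), (l, m, l), (m, l, l)} \<and>
      (a', b', c') \<in> {(l, m, m), (m, l, m), (m, m, l)})"
    by simp metis
  then show thesis using that by blast
qed

lemma isometric_three:
  fixes A B :: "complex^'n^'n"
  assumes card: "CARD('n) = 3" and res: "\<And>z. resolvent_norm A z = resolvent_norm B z"
  shows "spec_norm (poly_mat p A) = spec_norm (poly_mat p B)"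
proof -
  obtain a b c where A: "trace A = a + b + c" "sym2 A = a * b + a * c + b * c" "det A = a * b * c"
    by (rule cubic_roots)
  obtain a' b' c' where B: "trace B = a' + b' + c'" "sym2 B = a' * b' + a' * c' + b' * c'"
      "det B = a' * b' * c'"
    by (rule cubic_roots)
  have detA: "det (mat z - A) = (z - a) * (z - b) * (z - c)" for z
    by (simp add: det_mat_minus[OF card] A algebra_simps power2_eq_square power3_eq_cube)
  have detB: "det (mat z - B) = (z - a') * (z - b') * (z - c')" for z
    by (simp add: det_mat_minus[OF card] B algebra_simps power2_eq_square power3_eq_cube)
  \<comment> \<open>Infinite values of the resolvent norm mark the eigenvalues, so the spectra agree
    as sets; multiplicities remain open.\<close>
  have "det (mat z - A) = 0 \<longleftrightarrow> det (mat z - B) = 0" for z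
    using res[of z] by (metis resolvent_norm_infinite_iff)
  then have "z \<in> {a, b, c} \<longleftrightarrow> z \<in> {a', b', c'}" for z
    by (simp add: detA detB)
  then have "{a, b, c} = {a', b', c'}"
    by blast
  then show ?thesis
  proof (cases rule: triple_same_set)
    case 1
    then have "trace A = trace B" "sym2 A = sym2 B" "det A = det B"
      unfolding A B by (auto simp: algebra_simps)
    then show ?thesis
      using gram_eq_if_resolvent_norm_eq[OF card res] isometric_if_gram_eq[OF card] by blast
  next
    case (2 l m)
    have "trace A = 2 * l + m" "sym2 A = l\<^sup>2 + 2 * l * m" "det A = l\<^sup>2 * m"
      using 2(2) unfolding A by (auto simp: algebra_simps power2_eq_square)
    moreover have "trace B = l + 2 * m" "sym2 B = m\<^sup>2 + 2 * l * m" "det B = l * m\<^sup>2"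
      using 2(3) unfolding B by (auto simp: algebra_simps power2_eq_square)
    ultimately show ?thesis
      using isometric_if_quadratic[OF quadratic_annihilator[OF card res] res] 2(1) by blast
  qed
qed

lemma
  fixes A :: "complex^'n^'n"
  assumes "CARD('n) = 2"
  shows det_mat_minus_two: "det (mat z - A) = poly [:det A, - trace A, 1:] z"
    and cayley_hamilton_two: "poly_mat [:det A, - trace A, 1:] A = 0"
proof -
  obtain i j :: 'n where u: "UNIV = {i, j}" and ne: "i \<noteq> j"
    using assms card_2_iff[of "UNIV :: 'n set"] by metis
  have all: "(\<forall>x. P x) \<longleftrightarrow> P i \<and> P j" for P
    using u by (metis UNIV_I empty_iff insert_iff)
  show "det (mat z - A) = poly [:det A, - trace A, 1:] z"
    unfolding det_two[OF u ne] trace_def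
    using ne ne[symmetric] by (simp add: mat_nth u algebra_simps)
  show "poly_mat [:det A, - trace A, 1:] A = 0"
    unfolding poly_mat_quadratic vec_eq_iff all det_two[OF u ne] trace_def
    using ne ne[symmetric] by (simp add: matrix_matrix_mult_def mat_nth u algebra_simps)
qed

lemma isometric_two:
  fixes A B :: "complex^'n^'n"
  assumes card: "CARD('n) = 2" and res: "\<And>z. resolvent_norm A z = resolvent_norm B z"
  shows "spec_norm (poly_mat p A) = spec_norm (poly_mat p B)"
proof -
  obtain a b where A: "trace A = a + b" "det A = a * b"
    by (rule quadratic_roots)
  obtain a' b' where B: "trace B = a' + b'" "det B = a' * b'"
    by (rule quadratic_roots)
  have detA: "det (mat z - A) = (z - a) * (z - b)" for z
    by (simp add: det_mat_minus_two[OF card] A algebra_simps)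
  have detB: "det (mat z - B) = (z - a') * (z - b')" for z
    by (simp add: det_mat_minus_two[OF card] B algebra_simps)
  have "det (mat z - A) = 0 \<longleftrightarrow> det (mat z - B) = 0" for z
    using res[of z] by (metis resolvent_norm_infinite_iff)
  then have "z \<in> {a, b} \<longleftrightarrow> z \<in> {a', b'}" for z
    by (simp add: detA detB)
  then have "{a, b} = {a', b'}"
    by blast
  \<comment> \<open>Unlike triples, pairs with the same underlying set agree up to order, so the
    characteristic polynomials already coincide.\<close>
  then have "trace A = trace B" "det A = det B"
    unfolding A B by (auto simp: doubleton_eq_iff algebra_simps)
  then show ?thesis
    using isometric_if_quadratic[OF cayley_hamilton_two[OF card, of A] _ res]
      cayley_hamilton_two[OF card, of B] by simp
qed

section \<open>Polynomial isometry determines the resolvent norm\<close>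

lemma inverse_poly_mat:
  fixes A :: "complex^'n^'n"
  assumes "CARD('n) = 2 \<or> CARD('n) = 3" "det (mat z - A) \<noteq> 0"
  obtains q where "(mat z - A) ** poly_mat q A = mat 1"
  using assms(1)
proof
  assume card: "CARD('n) = 2"
  show thesis
    using poly_mat_quadratic_inverse[OF cayley_hamilton_two[OF card, of A]] assms(2) that
    unfolding det_mat_minus_two[OF card] by (metis poly_mat_smult)
next
  assume card: "CARD('n) = 3"
  show thesis
    using adj3_inverse[OF card assms(2)] that
    unfolding adj3_mat_minus[OF card] by (metis poly_mat_smult)
qed

lemma resolvent_norm_eq_if_isometric:
  fixes A B :: "complex^'n^'n"
  assumes "CARD('n) = 2 \<or> CARD('n) = 3" "det (mat z - A) \<noteq> 0"
    and iso: "\<And>p. spec_norm (poly_mat p A) = spec_norm (poly_mat p B)"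
  shows "resolvent_norm A z = resolvent_norm B z"
proof -
  obtain q where q: "(mat z - A) ** poly_mat q A = mat 1"
    using inverse_poly_mat[OF assms(1,2)] .
  have p: "mat z - M = poly_mat [:z, -1, 0:] M" for M :: "complex^'n^'n"
    unfolding poly_mat_quadratic by (simp add: vec_eq_iff)
  have "poly_mat ([:z, -1, 0:] * q - 1) A = 0"
    using q unfolding p by (simp only: poly_mat_diff poly_mat_mult poly_mat_1) simp
  then have "poly_mat ([:z, -1, 0:] * q - 1) B = 0"
    using iso[of "[:z, -1, 0:] * q - 1"] by (metis spec_norm_eq_0_iff)
  then have "(mat z - B) ** poly_mat q B = mat 1"
    unfolding p by (simp only: poly_mat_diff poly_mat_mult poly_mat_1) simp
  then show ?thesis
    using q iso[of q] by (simp add: resolvent_norm_eq)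
qed

theorem theorem1:
  fixes A B :: "complex^'n^'n"
  assumes "CARD('n) = 2 \<or> CARD('n) = 3"
  shows "(\<forall>z. resolvent_norm A z = resolvent_norm B z) \<longleftrightarrow>
         (\<forall>p. spec_norm (poly_mat p A) = spec_norm (poly_mat p B))"
proof
  assume "\<forall>z. resolvent_norm A z = resolvent_norm B z"
  then show "\<forall>p. spec_norm (poly_mat p A) = spec_norm (poly_mat p B)"
    using assms isometric_two[of A B] isometric_three[of A B] by blast
next
  assume iso: "\<forall>p. spec_norm (poly_mat p A) = spec_norm (poly_mat p B)"
  show "\<forall>z. resolvent_norm A z = resolvent_norm B z"
  proof
    fix z
    show "resolvent_norm A z = resolvent_norm B z"
    proof (cases "det (mat z - A) = 0 \<and> det (mat z - B) = 0")
      case True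
      then show ?thesis
        by (metis resolvent_norm_infinite_iff)
    next
      \<comment> \<open>One of the two determinants is nonzero, and the lemma is applied with that
        matrix in first place.\<close>
      case False
      then show ?thesis
        using iso resolvent_norm_eq_if_isometric[OF assms, of z A B]
          resolvent_norm_eq_if_isometric[OF assms, of z B A] by metis
    qed
  qed
qed

end
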